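(* Let $n\ge 3$ and let $a_1,a_2$ be positive integers with $a_1+a_2=n$. The matching field ideal $\mathcal{I}_{B\Lambda_{a_1,a_2}}$ of the $2$-block diagonal matching field $B\Lambda_{a_1,a_2}$ of size $3\times n$ is quadratically generated, i.e. generated by homogeneous elements of degree $2$.
   Context: Fix a field $\mathbb{K}$. Write $[n]=\{1,\dots,n\}$ and let $\mathbf{I}_{3,n}$ be the set of $3$-element subsets of $[n]$. A $3\times n$ matching field is a map $\Lambda:\mathbf{I}_{3,n}\to S_3$. For $I=\{i_1<i_2<i_3\}$ and $\sigma=\Lambda(I)$ put $\mathbf{x}_{\Lambda(I)}=x_{\sigma(1)i_1}x_{\sigma(2)i_2}x_{\sigma(3)i_3}$. The matching field ideal $\mathcal{I}_\Lambda\subset\mathbb{K}[P_I: I\in\mathbf{I}_{3,n}]$ (each variable $P_I$ of degree $1$) is the kernel of the $\mathbb{K}$-algebra map $\mathbb{K}[P_I]\to\mathbb{K}[x_{ij}: 1\le i\le 3,\,1\le j\le n]$, $P_I\mapsto\mathrm{sgn}(\Lambda(I))\,\mathbf{x}_{\Lambda(I)}$. $2$-block diagonal matching field: let $I_1=\{1,\dots,a_1\}$ and $I_2=\{a_1+1,\dots,n\}$. For $I\in\mathbf{I}_{3,n}$ let $s$ be the minimal $t\in\{1,2\}$ with $I_t\cap I\ne\emptyset$. Then $B\Lambda_{a_1,a_2}(I)=\mathrm{id}$ if $|I\cap I_s|\ge 2$, and $B\Lambda_{a_1,a_2}(I)=(12)$ (the transposition of $1$ and $2$) if $|I\cap I_s|=1$.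 *)

theory Defs
  imports
    "HOL-Algebra.Ideal"
    "HOL-Algebra.RingHom"
    "HOL-Combinatorics.Permutations"
    "HOL-Library.Poly_Mapping"
begin

type_synonym ('v, 'k) mpoly = "('v \<Rightarrow>\<^sub>0 nat) \<Rightarrow>\<^sub>0 'k"

definition Var :: "'v \<Rightarrow> ('v, 'k::comm_ring_1) mpoly" where
  "Var v = Poly_Mapping.single (Poly_Mapping.single v 1) 1"

definition Const :: "'k \<Rightarrow> ('v, 'k::comm_ring_1) mpoly" where
  "Const c = Poly_Mapping.single 0 c"

definition indets :: "('v, 'k::comm_ring_1) mpoly \<Rightarrow> 'v set" where
  "indets p = (\<Union>m\<in>Poly_Mapping.keys p. Poly_Mapping.keys m)"

text \<open>The type provides a variable for every element of \<open>'v\<close>; the ring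
  \<open>K[V]\<close> consists of the polynomials that only involve variables from \<open>V\<close>.\<close>

definition poly_ring :: "'v set \<Rightarrow> ('v, 'k::comm_ring_1) mpoly ring" where
  "poly_ring V = \<lparr>carrier = {p. indets p \<subseteq> V}, monoid.mult = (*), one = 1,
     ring.zero = 0, add = (+)\<rparr>"

definition mdegree :: "('v \<Rightarrow>\<^sub>0 nat) \<Rightarrow> nat" where
  "mdegree m = (\<Sum>v\<in>Poly_Mapping.keys m. Poly_Mapping.lookup m v)"

definition homogeneous :: "nat \<Rightarrow> ('v, 'k::comm_ring_1) mpoly \<Rightarrow> bool" where
  "homogeneous d p \<longleftrightarrow> (\<forall>m\<in>Poly_Mapping.keys p. mdegree m = d)"

definition quadratically_generated :: "'v set \<Rightarrow> ('v, 'k::comm_ring_1) mpoly set \<Rightarrow> bool" where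
  "quadratically_generated V J \<longleftrightarrow>
     (\<exists>G \<subseteq> carrier (poly_ring V). (\<forall>g\<in>G. homogeneous 2 g) \<and> J = Idl\<^bsub>poly_ring V\<^esub> G)"

text \<open>The homomorphism of algebras over the coefficient ring that sends each variable \<open>v\<close>
  to \<open>\<phi> v\<close>.\<close>

definition poly_subst ::
    "('v \<Rightarrow> ('w, 'k::comm_ring_1) mpoly) \<Rightarrow> ('v, 'k) mpoly \<Rightarrow> ('w, 'k) mpoly" where
  "poly_subst \<phi> p = (\<Sum>m\<in>Poly_Mapping.keys p.
     Const (Poly_Mapping.lookup p m) *
     (\<Prod>v\<in>Poly_Mapping.keys m. \<phi> v ^ Poly_Mapping.lookup m v))"

definition triples :: "nat \<Rightarrow> nat set set" where
  "triples n = {I. I \<subseteq> {1..n} \<and> card I = 3}"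

definition matching_field :: "nat \<Rightarrow> (nat set \<Rightarrow> nat \<Rightarrow> nat) \<Rightarrow> bool" where
  "matching_field n \<Lambda> \<longleftrightarrow> (\<forall>I\<in>triples n. \<Lambda> I permutes {1..3})"

text \<open>The \<open>k\<close>-th smallest element of \<open>I\<close>, counting from \<open>1\<close>, is
  \<open>sorted_list_of_set I ! (k - 1)\<close>. The variable \<open>x\<^sub>i\<^sub>j\<close> is \<open>Var (i, j)\<close>.\<close>

definition matching_monomial ::
    "(nat set \<Rightarrow> nat \<Rightarrow> nat) \<Rightarrow> nat set \<Rightarrow> (nat \<times> nat, 'k::comm_ring_1) mpoly" where
  "matching_monomial \<Lambda> I = (\<Prod>k\<in>{1..3}. Var (\<Lambda> I k, sorted_list_of_set I ! (k - 1)))"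

definition matching_field_map ::
    "(nat set \<Rightarrow> nat \<Rightarrow> nat) \<Rightarrow> (nat set, 'k::comm_ring_1) mpoly \<Rightarrow> (nat \<times> nat, 'k) mpoly" where
  "matching_field_map \<Lambda> = poly_subst (\<lambda>I. of_int (sign (\<Lambda> I)) * matching_monomial \<Lambda> I)"

definition matching_field_ideal ::
    "nat \<Rightarrow> (nat set \<Rightarrow> nat \<Rightarrow> nat) \<Rightarrow> (nat set, 'k::comm_ring_1) mpoly set" where
  "matching_field_ideal n \<Lambda> =
     a_kernel (poly_ring (triples n)) (poly_ring ({1..3} \<times> {1..n})) (matching_field_map \<Lambda>)"

definition block :: "nat \<Rightarrow> nat \<Rightarrow> nat \<Rightarrow> nat set" where
  "block a1 a2 t = (if t = 1 then {1..a1} else {a1 + 1..a1 + a2})"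

definition block_diagonal :: "nat \<Rightarrow> nat \<Rightarrow> nat set \<Rightarrow> nat \<Rightarrow> nat" where
  "block_diagonal a1 a2 I =
     (let s = (LEAST t. t \<in> {1, 2} \<and> block a1 a2 t \<inter> I \<noteq> {})
      in if card (I \<inter> block a1 a2 s) \<ge> 2 then id else transpose 1 2)"

lemma matching_field_block_diagonal: "matching_field n (block_diagonal a1 a2)"
  by (auto simp: matching_field_def block_diagonal_def Let_def
      intro: permutes_id permutes_swap_id)

text \<open>The last case of \<open>block_diagonal\<close> is the case of exactly one common element.\<close>

lemma card_first_block_pos:
  assumes "I \<in> triples (a1 + a2)"
  defines "s \<equiv> (LEAST t. t \<in> {1, 2} \<and> block a1 a2 t \<inter> I \<noteq> {})"
  shows "card (I \<inter> block a1 a2 s) \<ge> 1"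
proof -
  have "I \<noteq> {}" "I \<subseteq> {1..a1 + a2}" and fin: "finite I"
    using assms(1) by (auto simp: triples_def intro: finite_subset)
  then obtain i where i: "i \<in> I" "1 \<le> i" "i \<le> a1 + a2" by fastforce
  define t :: nat where "t = (if i \<le> a1 then 1 else 2)"
  have "i \<in> block a1 a2 t" "t \<in> {1, 2}"
    using i by (auto simp: t_def block_def)
  with i(1) have "t \<in> {1, 2} \<and> block a1 a2 t \<inter> I \<noteq> {}" by blast
  then have "s \<in> {1, 2} \<and> block a1 a2 s \<inter> I \<noteq> {}"
    unfolding s_def by (rule LeastI)
  then have "card (I \<inter> block a1 a2 s) \<noteq> 0"
    using fin by (auto simp: card_eq_0_iff)
  then show ?thesis by simp
qed

lemma indets_add: "indets (p + q) \<subseteq> indets p \<union> indets q"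
  using Poly_Mapping.keys_add[of p q] by (fastforce simp: indets_def)

lemma indets_mult: "indets (p * q) \<subseteq> indets p \<union> indets q"
proof
  fix v assume "v \<in> indets (p * q)"
  then obtain m where m: "m \<in> Poly_Mapping.keys (p * q)" "v \<in> Poly_Mapping.keys m"
    by (auto simp: indets_def)
  then obtain a b where "a \<in> Poly_Mapping.keys p" "b \<in> Poly_Mapping.keys q" "m = a + b"
    using Poly_Mapping.keys_mult[of p q] by auto
  then show "v \<in> indets p \<union> indets q"
    using m(2) Poly_Mapping.keys_add[of a b] by (auto simp: indets_def)
qed

lemma indets_uminus: "indets (- p) = indets p"
  by (simp add: indets_def)

lemma cring_poly_ring: "cring (poly_ring V :: ('v, 'k::comm_ring_1) mpoly ring)"
proof (rule cringI)
  show "abelian_group (poly_ring V :: ('v, 'k) mpoly ring)"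
  proof (rule abelian_groupI)
    fix p :: "('v, 'k) mpoly" assume "p \<in> carrier (poly_ring V)"
    then have "- p \<in> carrier (poly_ring V)" "- p + p = 0"
      by (simp_all add: poly_ring_def indets_uminus)
    then show "\<exists>q\<in>carrier (poly_ring V). q \<oplus>\<^bsub>poly_ring V\<^esub> p = \<zero>\<^bsub>poly_ring V\<^esub>"
      by (auto simp: poly_ring_def)
  next
    fix p q :: "('v, 'k) mpoly"
    assume "p \<in> carrier (poly_ring V)" "q \<in> carrier (poly_ring V)"
    then show "p \<oplus>\<^bsub>poly_ring V\<^esub> q \<in> carrier (poly_ring V)"
      using indets_add[of p q] by (auto simp: poly_ring_def)
  qed (auto simp: poly_ring_def indets_def algebra_simps)
  show "comm_monoid (poly_ring V :: ('v, 'k) mpoly ring)"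
  proof (rule comm_monoidI)
    fix p q :: "('v, 'k) mpoly"
    assume "p \<in> carrier (poly_ring V)" "q \<in> carrier (poly_ring V)"
    then show "p \<otimes>\<^bsub>poly_ring V\<^esub> q \<in> carrier (poly_ring V)"
      using indets_mult[of p q] by (auto simp: poly_ring_def)
  qed (auto simp: poly_ring_def indets_def algebra_simps)
qed (auto simp: poly_ring_def algebra_simps)

end

theory Submission imports Defs "HOL-Library.Multiset" begin

text \<open>The matching field sends a triple to a monomial \<open>x\<^sub>1\<^sub>p x\<^sub>2\<^sub>q x\<^sub>3\<^sub>r\<close>, that is, to a column \<open>(p, q, r)\<close>, and a
  monomial in the variables \<open>P\<^sub>I\<close> corresponds to a tableau, a multiset of columns. Two monomials have
  the same image up to sign if and only if the tableaux have the same three rows as multisets. The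
  ideal is therefore spanned by signed binomials of pairs of tableaux with equal rows
  (\<open>kernel_poly_subst_subset_ideal\<close>), and it is generated by quadrics as soon as any two
  such tableaux are connected by moves that change only two columns at a time
  (\<open>same_rows_connected\<close>).

  Call an entry low if it lies in the first block and high otherwise. The admissible columns are
  those in which \<open>r\<close> exceeds \<open>p\<close> and \<open>q\<close>, and \<open>p\<close> precedes \<open>q\<close> in the order that lists the high entries
  before the low ones. A column thus consists of low entries only, or of two low entries followed by a
  high one, or it has a high first and third entry, with the second entry either low or high. Connectedness
  is proved by induction on the number of columns: from the rows alone one can name an extremal
  column that every tableau with these rows can produce by moves (\<open>reaches_extremal_column\<close>); removing
  it leaves smaller tableaux with equal rows. The extremal column is one of the second kind if there is
  any, else one of the first kind if there is any, else one of the remaining kinds. In each case its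
  entries are the greatest (or, where this is harmless, the least) that the inequalities
  admit, and each is fetched by a single exchange with the column that holds it.\<close>

section \<open>Tableaux and quadratic moves\<close>

type_synonym column = "nat \<times> nat \<times> nat"

text \<open>The column \<open>(p, q, r)\<close> stands for the monomial \<open>x\<^sub>1\<^sub>p x\<^sub>2\<^sub>q x\<^sub>3\<^sub>r\<close>. The monomials of the
  block diagonal matching field whose first block is \<open>{1..a}\<close> are those with \<open>p < r\<close>, \<open>q < r\<close> and
  \<open>p\<close> before \<open>q\<close> in the order \<open>a + 1, \<dots>, n, 1, \<dots>, a\<close>; the last line spells out this order. Below, an
  entry is called low if it is at most \<open>a\<close> and high otherwise.\<close>

definition columns :: "nat \<Rightarrow> nat \<Rightarrow> column set" where
  "columns a n = {(p, q, r). 1 \<le> p \<and> 1 \<le> q \<and> p < r \<and> q < r \<and> r \<le> n \<and>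
     (a < p \<and> q \<le> a \<or> p < q \<and> (a < p \<or> q \<le> a))}"

definition rows :: "column multiset \<Rightarrow> nat multiset \<times> nat multiset \<times> nat multiset" where
  "rows T = (image_mset fst T, image_mset (fst \<circ> snd) T, image_mset (snd \<circ> snd) T)"

text \<open>A move exchanges entries within the rows of two columns; it is the combinatorial form of a
  binomial of degree \<open>2\<close> in the ideal, multiplied by a monomial.\<close>

inductive quad_move :: "nat \<Rightarrow> nat \<Rightarrow> column multiset \<Rightarrow> column multiset \<Rightarrow> bool" for a n where
  "{c, d, c', d'} \<union> set_mset M \<subseteq> columns a n \<Longrightarrow> rows {#c, d#} = rows {#c', d'#} \<Longrightarrow>
     quad_move a n (add_mset c (add_mset d M)) (add_mset c' (add_mset d' M))"

abbreviation connected :: "nat \<Rightarrow> nat \<Rightarrow> column multiset \<Rightarrow> column multiset \<Rightarrow> bool" where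
  "connected a n \<equiv> (quad_move a n)\<^sup>*\<^sup>*"

lemma rows_add_mset_cancel:
  "rows (add_mset c M) = rows (add_mset c M') \<longleftrightarrow> rows M = rows M'"
  by (auto simp: rows_def)

lemma rows_pair_cancel:
  "rows {#c, d#} = rows {#c', d'#} \<Longrightarrow>
     rows (add_mset c (add_mset d M)) = rows (add_mset c' (add_mset d' M))"
  by (auto simp: rows_def add_mset_commute)

lemma quad_move_sym: "quad_move a n T T' \<Longrightarrow> quad_move a n T' T"
  by (erule quad_move.cases) (auto intro!: quad_move.intros)

lemma connected_sym: "connected a n T T' \<Longrightarrow> connected a n T' T"
  using symp_rtranclp[of "quad_move a n"] by (blast intro: sympI quad_move_sym dest: sympD)

lemma connected_rows: "connected a n T T' \<Longrightarrow> rows T = rows T'"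
  by (induction rule: rtranclp_induct) (auto elim!: quad_move.cases dest: rows_pair_cancel)

lemma connected_columns:
  "connected a n T T' \<Longrightarrow> set_mset T \<subseteq> columns a n \<Longrightarrow> set_mset T' \<subseteq> columns a n"
  by (induction rule: rtranclp_induct) (auto elim!: quad_move.cases)

lemma quad_move_add_mset:
  assumes "quad_move a n T T'" "e \<in> columns a n"
  shows "quad_move a n (add_mset e T) (add_mset e T')"
  using assms(1)
proof cases
  case (1 c d c' d' M)
  with assms(2) have "quad_move a n (add_mset c (add_mset d (add_mset e M)))
      (add_mset c' (add_mset d' (add_mset e M)))"
    by (intro quad_move.intros) auto
  with 1 show ?thesis by (simp add: add_mset_commute)
qed

lemma connected_add_mset:
  "connected a n T T' \<Longrightarrow> e \<in> columns a n \<Longrightarrow> connected a n (add_mset e T) (add_mset e T')"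
  by (induction rule: rtranclp_induct) (auto intro: rtranclp.rtrancl_into_rtrancl quad_move_add_mset)

definition reaches :: "nat \<Rightarrow> nat \<Rightarrow> column multiset \<Rightarrow> column \<Rightarrow> bool" where
  "reaches a n T c \<longleftrightarrow> set_mset T \<subseteq> columns a n \<and> (\<exists>M. connected a n T (add_mset c M))"

lemma reachesI: "set_mset T \<subseteq> columns a n \<Longrightarrow> c \<in># T \<Longrightarrow> reaches a n T c"
  unfolding reaches_def by (metis insert_DiffM rtranclp.rtrancl_refl)

lemma reaches_entries:
  assumes "reaches a n T (p, q, r)" and "rows T = (A, B, C)"
  shows "(p, q, r) \<in> columns a n" "p \<in># A" "q \<in># B" "r \<in># C"
proof -
  obtain M where M: "connected a n T (add_mset (p, q, r) M)"
    using assms(1) by (auto simp: reaches_def)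
  then show "(p, q, r) \<in> columns a n"
    using connected_columns[OF M] assms(1) by (auto simp: reaches_def)
  have "rows (add_mset (p, q, r) M) = (A, B, C)"
    using connected_rows[OF M] assms(2) by simp
  then show "p \<in># A" "q \<in># B" "r \<in># C"
    by (auto simp: rows_def)
qed

text \<open>Every tableau connected to \<open>T\<close> has the same rows, so an entry \<open>x\<close> of a row of \<open>T\<close> still occurs
  there, if not in \<open>c\<close> then in another column, and a move of these two can bring it into \<open>c\<close>. A column with
  prescribed entries is built by using this once per entry; \<open>P\<close> records what has been achieved.\<close>

lemma reaches_exchange:
  assumes c: "reaches a n T c"
    and f: "f \<in> {fst, fst \<circ> snd, snd \<circ> snd}" and x: "x \<in># image_mset f T"
    and here: "f c = x \<Longrightarrow> P c"
    and swap: "\<And>p q r. reaches a n T (p, q, r) \<Longrightarrow> f (p, q, r) = x \<Longrightarrow>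
       \<exists>c' d'. c' \<in> columns a n \<and> d' \<in> columns a n \<and>
         rows {#c, (p, q, r)#} = rows {#c', d'#} \<and> P c'"
  shows "\<exists>c'. reaches a n T c' \<and> P c'"
proof -
  obtain M where M: "connected a n T (add_mset c M)" and T: "set_mset T \<subseteq> columns a n"
    using c by (auto simp: reaches_def)
  have "image_mset f T = image_mset f (add_mset c M)"
    using connected_rows[OF M] f by (auto simp: rows_def)
  with x consider "f c = x" | d where "d \<in># M" "f d = x" by auto
  then show ?thesis
  proof cases
    case 1
    with here c show ?thesis by blast
  next
    case 2
    then obtain M' where M': "M = add_mset d M'" by (metis insert_DiffM)
    obtain p q r where d: "d = (p, q, r)" by (cases d)
    have "reaches a n T d"
      using M T unfolding reaches_def M' by (metis add_mset_commute)
    then obtain c' d' where cd: "c' \<in> columns a n" "d' \<in> columns a n"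
        "rows {#c, d#} = rows {#c', d'#}" "P c'"
      using swap 2(2) d by blast
    have "quad_move a n (add_mset c (add_mset d M')) (add_mset c' (add_mset d' M'))"
      using cd connected_columns[OF M T] by (intro quad_move.intros) (auto simp: M')
    with M have "connected a n T (add_mset c' (add_mset d' M'))" by (simp add: M')
    with T have "reaches a n T c'" by (auto simp only: reaches_def)
    with cd(4) show ?thesis by (intro exI[of _ c'] conjI)
  qed
qed

section \<open>Extremal columns\<close>

lemma Max_filter:
  assumes "x \<in># A" "Q x"
  shows "Max {x \<in> set_mset A. Q x} \<in># A" "Q (Max {x \<in> set_mset A. Q x})"
    "\<And>y. y \<in># A \<Longrightarrow> Q y \<Longrightarrow> y \<le> Max {x \<in> set_mset A. Q x}"
  using assms Max_in[of "{x \<in> set_mset A. Q x}"] by (auto intro: Max_ge)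

lemma Min_filter:
  assumes "x \<in># A" "Q x"
  shows "Min {x \<in> set_mset A. Q x} \<in># A" "Q (Min {x \<in> set_mset A. Q x})"
    "\<And>y. y \<in># A \<Longrightarrow> Q y \<Longrightarrow> Min {x \<in> set_mset A. Q x} \<le> y"
  using assms Min_in[of "{x \<in> set_mset A. Q x}"] by (auto intro: Min_le)

text \<open>A column with two low entries and a high one bounds its first two entries from above only by
  each other, and its third entry is bounded from below only by low entries. So it can collect
  the largest low entries of the first two rows and the smallest high entry of the third.\<close>

lemma reaches_low_low_high:
  assumes T: "rows T = (A, B, C)"
    and c: "reaches a n T (p, q, r)" "p \<le> a" "a < r"
  shows "reaches a n T (Max {p \<in> set_mset A. p \<le> a}, Max {q \<in> set_mset B. q \<le> a},
     Min {r \<in> set_mset C. a < r})"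
proof -
  define P where "P = Max {p \<in> set_mset A. p \<le> a}"
  define Q where "Q = Max {q \<in> set_mset B. q \<le> a}"
  define R where "R = Min {r \<in> set_mset C. a < r}"
  note pqr = reaches_entries[OF c(1) T]
  from pqr c(2) have q: "q \<le> a" by (auto simp: columns_def)
  note P = Max_filter[of p A "\<lambda>p. p \<le> a", OF pqr(2) c(2), folded P_def]
  note Q = Max_filter[of q B "\<lambda>q. q \<le> a", OF pqr(3) q, folded Q_def]
  note R = Min_filter[of r C "\<lambda>r. a < r", OF pqr(4) c(3), folded R_def]
  have rows: "image_mset fst T = A" "image_mset (fst \<circ> snd) T = B" "image_mset (snd \<circ> snd) T = C"
    using T by (simp_all add: rows_def)
  have "\<exists>c'. reaches a n T c' \<and> (\<exists>q r. c' = (P, q, r) \<and> a < r)"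
  proof (rule reaches_exchange[OF c(1), of fst P])
    fix p' q' r' assume d: "reaches a n T (p', q', r')" and "fst (p', q', r') = P"
    then have [simp]: "p' = P" by simp
    note e = reaches_entries[OF d T]
    show "\<exists>c' d'. c' \<in> columns a n \<and> d' \<in> columns a n \<and>
       rows {#(p, q, r), (p', q', r')#} = rows {#c', d'#} \<and> (\<exists>q r. c' = (P, q, r) \<and> a < r)"
    proof (cases "P < q")
      case True
      then have "(P, q, r) \<in> columns a n" "(p, q', r') \<in> columns a n"
        using pqr e P(1,2) c q P(3)[OF pqr(2) c(2)] by (auto simp: columns_def)
      then show ?thesis using c by (intro exI[of _ "(p', q, r)"] exI[of _ "(p, q', r')"])
         (auto simp: rows_def add_mset_commute)
    next
      case False
      \<comment> \<open>Now \<open>q \<le> P\<close>, so \<open>q\<close> stays below \<open>q'\<close> and \<open>r'\<close>, and \<open>P\<close> can bring its \<open>q'\<close> along.\<close>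
      then have "(P, q', r) \<in> columns a n" "(p, q, r') \<in> columns a n"
        using pqr e P c q by (auto simp: columns_def)
      then show ?thesis using c by (intro exI[of _ "(p', q', r)"] exI[of _ "(p, q, r')"])
         (auto simp: rows_def add_mset_commute)
    qed
  qed (use P rows c in auto)
  then obtain q1 r1 where c1: "reaches a n T (P, q1, r1)" "a < r1" by blast
  note pqr1 = reaches_entries[OF c1(1) T]
  have "\<exists>c'. reaches a n T c' \<and> c' = (P, Q, r1)"
  proof (rule reaches_exchange[OF c1(1), of "fst \<circ> snd" Q])
    fix p' q' r' assume d: "reaches a n T (p', q', r')" and "(fst \<circ> snd) (p', q', r') = Q"
    then have [simp]: "q' = Q" by simp
    note e = reaches_entries[OF d T]
    have "q1 \<le> Q" using P Q pqr1 by (auto simp: columns_def)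
    moreover have "p' \<le> P" if "p' \<le> a" using P(3) e(2) that .
    ultimately have "(P, Q, r1) \<in> columns a n" "(p', q1, r') \<in> columns a n"
      using pqr1 e P(1,2) Q(1,2) c1 by (auto simp: columns_def)
    then show "\<exists>c' d'. c' \<in> columns a n \<and> d' \<in> columns a n \<and>
       rows {#(P, q1, r1), (p', q', r')#} = rows {#c', d'#} \<and> c' = (P, Q, r1)"
      by (intro exI[of _ "(P, q', r1)"] exI[of _ "(p', q1, r')"])
         (auto simp: rows_def add_mset_commute)
  qed (use Q rows in auto)
  then have c2: "reaches a n T (P, Q, r1)" by simp
  note pqr2 = reaches_entries[OF c2 T]
  have "\<exists>c'. reaches a n T c' \<and> c' = (P, Q, R)"
  proof (rule reaches_exchange[OF c2, of "snd \<circ> snd" R])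
    fix p' q' r' assume d: "reaches a n T (p', q', r')" and "(snd \<circ> snd) (p', q', r') = R"
    then have [simp]: "r' = R" by simp
    note e = reaches_entries[OF d T]
    have "R \<le> r1" using R(3) pqr2(4) c1 by auto
    then have "(P, Q, R) \<in> columns a n" "(p', q', r1) \<in> columns a n"
      using pqr2 e P Q R by (auto simp: columns_def)
    then show "\<exists>c' d'. c' \<in> columns a n \<and> d' \<in> columns a n \<and>
       rows {#(P, Q, r1), (p', q', r')#} = rows {#c', d'#} \<and> c' = (P, Q, R)"
      by (intro exI[of _ "(P, Q, r')"] exI[of _ "(p', q', r1)"])
         (auto simp: rows_def add_mset_commute)
  qed (use R rows in auto)
  then show ?thesis by (simp add: P_def Q_def R_def)
qed

text \<open>If every column with a low first entry is entirely low, then the largest low entry \<open>R\<close> of the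
  third row can be put together with the largest low first entry \<open>P\<close>. The second entry of that column
  can then be raised to the largest value below \<open>R\<close>: the value that it gives up exceeds \<open>P\<close>, hence
  every low first entry, and so fits wherever the larger one did.\<close>

lemma reaches_low_low_low:
  assumes T: "rows T = (A, B, C)"
    and c: "reaches a n T (p, q, r)" "r \<le> a"
    and no_mixed: "\<And>p q r. reaches a n T (p, q, r) \<Longrightarrow> p \<le> a \<Longrightarrow> r \<le> a"
  defines "R \<equiv> Max {r \<in> set_mset C. r \<le> a}"
  shows "reaches a n T (Max {p \<in> set_mset A. p \<le> a}, Max {q \<in> set_mset B. q < R}, R)"
proof -
  define P where "P = Max {p \<in> set_mset A. p \<le> a}"
  define Q where "Q = Max {q \<in> set_mset B. q < R}"
  have rows: "image_mset fst T = A" "image_mset (fst \<circ> snd) T = B" "image_mset (snd \<circ> snd) T = C"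
    using T by (simp_all add: rows_def)
  note pqr = reaches_entries[OF c(1) T]
  note R = Max_filter[of r C "\<lambda>r. r \<le> a", OF pqr(4) c(2), folded R_def]
  obtain p0 q0 where c0: "reaches a n T (p0, q0, R)"
  proof -
    from R rows have "R \<in># image_mset (snd \<circ> snd) T" by simp
    then obtain p0 q0 where "(p0, q0, R) \<in># T" by auto
    moreover have "set_mset T \<subseteq> columns a n" using c(1) by (simp add: reaches_def)
    ultimately show ?thesis using that reachesI by blast
  qed
  note pqr0 = reaches_entries[OF c0 T]
  have p0: "p0 \<le> a" using pqr0(1) R by (auto simp: columns_def)
  note P = Max_filter[of p0 A "\<lambda>p. p \<le> a", OF pqr0(2) p0, folded P_def]
  have "\<exists>c'. reaches a n T c' \<and> (\<exists>q. c' = (P, q, R))"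
  proof (rule reaches_exchange[OF c0, of fst P])
    fix p' q' r' assume d: "reaches a n T (p', q', r')" and "fst (p', q', r') = P"
    then have [simp]: "p' = P" by simp
    note e = reaches_entries[OF d T]
    have r': "r' \<le> a" using no_mixed[OF d] P by simp
    with R(3) e(4) have "r' \<le> R" by blast
    show "\<exists>c' d'. c' \<in> columns a n \<and> d' \<in> columns a n \<and>
       rows {#(p0, q0, R), (p', q', r')#} = rows {#c', d'#} \<and> (\<exists>q. c' = (P, q, R))"
    proof (cases "P < q0")
      case True
      then have "(P, q0, R) \<in> columns a n" "(p0, q', r') \<in> columns a n"
        using pqr0 e P(1,2) R(1,2) p0 r' \<open>r' \<le> R\<close> P(3)[OF pqr0(2) p0] by (auto simp: columns_def)
      then show ?thesis by (intro exI[of _ "(p', q0, R)"] exI[of _ "(p0, q', r')"])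
         (auto simp: rows_def add_mset_commute)
    next
      case False
      \<comment> \<open>Now \<open>q0 \<le> P\<close> and \<open>P < q' < r'\<close>, so \<open>R\<close> and \<open>r'\<close> can trade places.\<close>
      then have "(P, q', R) \<in> columns a n" "(p0, q0, r') \<in> columns a n"
        using pqr0 e P(1,2) R(1,2) p0 r' \<open>r' \<le> R\<close> P(3)[OF pqr0(2) p0] by (auto simp: columns_def)
      then show ?thesis by (intro exI[of _ "(p', q', R)"] exI[of _ "(p0, q0, r')"])
         (auto simp: rows_def add_mset_commute)
    qed
  qed (use P rows in auto)
  then obtain q1 where c1: "reaches a n T (P, q1, R)" by blast
  note pqr1 = reaches_entries[OF c1 T]
  from pqr1 have q1: "q1 < R" by (auto simp: columns_def)
  note Q = Max_filter[of q1 B "\<lambda>q. q < R", OF pqr1(3) q1, folded Q_def]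
  have "q1 \<le> Q" using Q pqr1 q1 by auto
  have "\<exists>c'. reaches a n T c' \<and> c' = (P, Q, R)"
  proof (rule reaches_exchange[OF c1, of "fst \<circ> snd" Q])
    fix p' q' r' assume d: "reaches a n T (p', q', r')" and "(fst \<circ> snd) (p', q', r') = Q"
    then have [simp]: "q' = Q" by simp
    note e = reaches_entries[OF d T]
    have "p' \<le> P" if "p' \<le> a" using P(3) e(2) that .
    then have "(P, Q, R) \<in> columns a n" "(p', q1, r') \<in> columns a n"
      using pqr1 e P(1,2) Q(1,2) R(1,2) q1 \<open>q1 \<le> Q\<close> by (auto simp: columns_def)
    then show "\<exists>c' d'. c' \<in> columns a n \<and> d' \<in> columns a n \<and>
       rows {#(P, q1, R), (p', q', r')#} = rows {#c', d'#} \<and> c' = (P, Q, R)"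
      by (intro exI[of _ "(P, q', R)"] exI[of _ "(p', q1, r')"])
         (auto simp: rows_def add_mset_commute)
  qed (use Q rows in auto)
  then show ?thesis by (simp add: P_def Q_def)
qed

text \<open>If all first entries are high, so are all third entries, and a low second entry imposes no
  condition at all: it can be exchanged with any other low one. Only high second entries \<open>q\<close>
  matter; they need \<open>p < q < r\<close>. The largest first and third entries can be put into one column,
  which takes the largest second entry if that exceeds \<open>P\<close>. Otherwise its second entry is
  necessarily low, and the largest low one is chosen.\<close>

lemma reaches_high_high:
  assumes T: "rows T = (A, B, C)" and cols: "set_mset T \<subseteq> columns a n" and "T \<noteq> {#}"
    and high: "\<And>p q r. reaches a n T (p, q, r) \<Longrightarrow> a < p"
  defines "P \<equiv> Max_mset A"
  shows "reaches a n T (P, if \<exists>q\<in>#B. P < q then Max_mset B else Max {q \<in> set_mset B. q \<le> a},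
    Max_mset C)"
proof -
  define R where "R = Max_mset C"
  have rows: "image_mset fst T = A" "image_mset (fst \<circ> snd) T = B" "image_mset (snd \<circ> snd) T = C"
    using T by (simp_all add: rows_def)
  have P: "P \<in># A" "\<And>p. p \<in># A \<Longrightarrow> p \<le> P"
    using rows \<open>T \<noteq> {#}\<close> by (auto simp: P_def)
  have R: "R \<in># C" "\<And>r. r \<in># C \<Longrightarrow> r \<le> R"
    using rows \<open>T \<noteq> {#}\<close> by (auto simp: R_def)
  obtain p0 q0 where c0: "reaches a n T (p0, q0, R)"
  proof -
    from R rows have "R \<in># image_mset (snd \<circ> snd) T" by simp
    then obtain p0 q0 where "(p0, q0, R) \<in># T" by auto
    then show ?thesis using that reachesI[OF cols] by blast
  qed
  note pqr0 = reaches_entries[OF c0 T]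
  have "\<exists>c'. reaches a n T c' \<and> (\<exists>q. c' = (P, q, R))"
  proof (rule reaches_exchange[OF c0, of fst P])
    fix p' q' r' assume d: "reaches a n T (p', q', r')" and "fst (p', q', r') = P"
    then have [simp]: "p' = P" by simp
    note e = reaches_entries[OF d T]
    have bounds: "a < p0" "a < P" "p0 \<le> P" "r' \<le> R"
      using high[OF c0] high[OF d] P(2)[OF pqr0(2)] R(2)[OF e(4)] by simp_all
    show "\<exists>c' d'. c' \<in> columns a n \<and> d' \<in> columns a n \<and>
       rows {#(p0, q0, R), (p', q', r')#} = rows {#c', d'#} \<and> (\<exists>q. c' = (P, q, R))"
    \<comment> \<open>A high \<open>q0\<close> that does not fit below \<open>r'\<close> exceeds \<open>P\<close>, so then the first entries are exchanged instead.\<close>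
    proof (cases "q0 < r'")
      case True
      then have "(P, q', R) \<in> columns a n" "(p0, q0, r') \<in> columns a n"
        using pqr0 e bounds by (auto simp: columns_def)
      then show ?thesis by (intro exI[of _ "(p', q', R)"] exI[of _ "(p0, q0, r')"])
         (auto simp: rows_def add_mset_commute)
    next
      case False
      then have "(P, q0, R) \<in> columns a n" "(p0, q', r') \<in> columns a n"
        using pqr0 e bounds by (auto simp: columns_def)
      then show ?thesis by (intro exI[of _ "(p', q0, R)"] exI[of _ "(p0, q', r')"])
         (auto simp: rows_def add_mset_commute)
    qed
  qed (use P rows in auto)
  then obtain q1 where c1: "reaches a n T (P, q1, R)" by blast
  note pqr1 = reaches_entries[OF c1 T]
  have aP: "a < P" using high[OF c1] .
  show ?thesis
  proof (cases "\<exists>q\<in>#B. P < q")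
    case True
    define Q where "Q = Max_mset B"
    have Q: "Q \<in># B" "\<And>q. q \<in># B \<Longrightarrow> q \<le> Q" "P < Q"
      using True by (auto simp: Q_def intro!: Max_in intro: less_le_trans)
    have "\<exists>c'. reaches a n T c' \<and> c' = (P, Q, R)"
    proof (rule reaches_exchange[OF c1, of "fst \<circ> snd" Q])
      fix p' q' r' assume d: "reaches a n T (p', q', r')" and "(fst \<circ> snd) (p', q', r') = Q"
      then have [simp]: "q' = Q" by simp
      note e = reaches_entries[OF d T]
      have "(P, Q, R) \<in> columns a n" "(p', q1, r') \<in> columns a n"
        using pqr1 e aP Q(3) high[OF d] P(2)[OF e(2)] R(2)[OF e(4)] Q(2)[OF pqr1(3)]
        by (auto simp: columns_def)
      then show "\<exists>c' d'. c' \<in> columns a n \<and> d' \<in> columns a n \<and>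
         rows {#(P, q1, R), (p', q', r')#} = rows {#c', d'#} \<and> c' = (P, Q, R)"
        by (intro exI[of _ "(P, q', R)"] exI[of _ "(p', q1, r')"])
         (auto simp: rows_def add_mset_commute)
    qed (use Q rows in auto)
    with True show ?thesis by (simp add: Q_def R_def)
  next
    case False
    define Q where "Q = Max {q \<in> set_mset B. q \<le> a}"
    have q1: "q1 \<le> a" using False pqr1 aP by (auto simp: columns_def)
    note Q = Max_filter[of q1 B "\<lambda>q. q \<le> a", OF pqr1(3) q1, folded Q_def]
    have "\<exists>c'. reaches a n T c' \<and> c' = (P, Q, R)"
    proof (rule reaches_exchange[OF c1, of "fst \<circ> snd" Q])
      fix p' q' r' assume d: "reaches a n T (p', q', r')" and "(fst \<circ> snd) (p', q', r') = Q"
      then have [simp]: "q' = Q" by simp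
      note e = reaches_entries[OF d T]
      have "(P, Q, R) \<in> columns a n" "(p', q1, r') \<in> columns a n"
        using pqr1 e aP Q(2) q1 high[OF d] by (auto simp: columns_def)
      then show "\<exists>c' d'. c' \<in> columns a n \<and> d' \<in> columns a n \<and>
         rows {#(P, q1, R), (p', q', r')#} = rows {#c', d'#} \<and> c' = (P, Q, R)"
        by (intro exI[of _ "(P, q', R)"] exI[of _ "(p', q1, r')"])
         (auto simp: rows_def add_mset_commute)
    qed (use Q rows in auto)
    with False show ?thesis by (simp add: Q_def R_def)
  qed
qed

text \<open>The column that the three lemmas above single out. It must depend on the rows only, so the case
  distinction is made by counting low entries; see \<open>mixed_column_iff\<close>.\<close>

definition extremal_column :: "nat \<Rightarrow> nat multiset \<times> nat multiset \<times> nat multiset \<Rightarrow> column" where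
  "extremal_column a = (\<lambda>(A, B, C).
     if size {#r \<in># C. r \<le> a#} < size {#p \<in># A. p \<le> a#} then
       (Max {p \<in> set_mset A. p \<le> a}, Max {q \<in> set_mset B. q \<le> a}, Min {r \<in> set_mset C. a < r})
     else if \<exists>r\<in>#C. r \<le> a then
       let R = Max {r \<in> set_mset C. r \<le> a}
       in (Max {p \<in> set_mset A. p \<le> a}, Max {q \<in> set_mset B. q < R}, R)
     else
       let P = Max_mset A
       in (P, if \<exists>q\<in>#B. P < q then Max_mset B else Max {q \<in> set_mset B. q \<le> a}, Max_mset C))"

text \<open>A column with a low third entry is entirely low. Hence the low entries of the third row count
  the entirely low columns, whereas the low entries of the first row count these and the columns
  with a low first and a high third entry.\<close>

lemma mixed_column_iff:
  assumes "rows T = (A, B, C)" "set_mset T \<subseteq> columns a n"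
  shows "(\<exists>c\<in>#T. fst c \<le> a \<and> a < snd (snd c)) \<longleftrightarrow>
    size {#r \<in># C. r \<le> a#} < size {#p \<in># A. p \<le> a#}"
proof -
  let ?X = "{#c \<in># T. snd (snd c) \<le> a#}" and ?Y = "{#c \<in># T. fst c \<le> a \<and> a < snd (snd c)#}"
  have "{#c \<in># T. fst c \<le> a#} = ?X + ?Y"
    using assms(2) by (induction T) (auto simp: columns_def)
  moreover have "size {#r \<in># C. r \<le> a#} = size ?X"
      "size {#p \<in># A. p \<le> a#} = size {#c \<in># T. fst c \<le> a#}"
    using assms(1) by (auto simp: rows_def filter_mset_image_mset)
  moreover have "0 < size ?Y \<longleftrightarrow> (\<exists>c\<in>#T. fst c \<le> a \<and> a < snd (snd c))"
    by (force simp flip: nonempty_has_size set_mset_eq_empty_iff)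
  ultimately show ?thesis by simp
qed

text \<open>The hypotheses of the three cases that concern all reachable columns hold because the kinds of
  columns that occur in a tableau can be read off from its rows.\<close>

lemma reaches_extremal_column:
  assumes cols: "set_mset T \<subseteq> columns a n" and "T \<noteq> {#}"
  shows "reaches a n T (extremal_column a (rows T))"
proof -
  obtain A B C where T: "rows T = (A, B, C)" by (cases "rows T")
  note mixed = mixed_column_iff[OF T cols]
  show ?thesis
  proof (cases "size {#r \<in># C. r \<le> a#} < size {#p \<in># A. p \<le> a#}")
    case True
    with mixed obtain p q r where "(p, q, r) \<in># T" "p \<le> a" "a < r" by fastforce
    with True show ?thesis
      using reaches_low_low_high[OF T reachesI[OF cols]] T by (auto simp: extremal_column_def)
  next
    case no_mixed: False
    have low: "r \<le> a" if "reaches a n T (p, q, r)" "p \<le> a" for p q r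
    proof (rule ccontr)
      assume "\<not> r \<le> a"
      obtain M where M: "connected a n T (add_mset (p, q, r) M)"
        using \<open>reaches a n T (p, q, r)\<close> by (auto simp: reaches_def)
      then show False
        using mixed_column_iff[OF _ connected_columns[OF M cols], of A B C]
          connected_rows[OF M] T no_mixed that(2) \<open>\<not> r \<le> a\<close> by auto
    qed
    show ?thesis
    proof (cases "\<exists>r\<in>#C. r \<le> a")
      case True
      then obtain p q r where "(p, q, r) \<in># T" "r \<le> a" using T by (auto simp: rows_def)
      then show ?thesis
        using reaches_low_low_low[OF T reachesI[OF cols] _ low] T no_mixed True
        by (auto simp: extremal_column_def Let_def)
    next
      case False
      have "a < p" if "reaches a n T (p, q, r)" for p q r
        using low[OF that] reaches_entries(4)[OF that T] False by (meson not_le_imp_less)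
      then show ?thesis
        using reaches_high_high[OF T cols \<open>T \<noteq> {#}\<close>] T no_mixed False
        by (auto simp: extremal_column_def Let_def)
    qed
  qed
qed

text \<open>Both tableaux reach the extremal column of their common rows; the remaining columns again have
  equal rows and are fewer.\<close>

proposition same_rows_connected:
  assumes "set_mset T \<subseteq> columns a n" "set_mset T' \<subseteq> columns a n" "rows T = rows T'"
  shows "connected a n T T'"
  using assms
proof (induction "size T" arbitrary: T T')
  case 0
  then show ?case by (auto simp: rows_def)
next
  case (Suc k)
  then have "T \<noteq> {#}" "T' \<noteq> {#}" by (auto simp: rows_def)
  let ?c = "extremal_column a (rows T)"
  obtain M where M: "connected a n T (add_mset ?c M)"
    using reaches_extremal_column[OF Suc.prems(1) \<open>T \<noteq> {#}\<close>] by (auto simp: reaches_def)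
  obtain M' where M': "connected a n T' (add_mset ?c M')"
    using reaches_extremal_column[OF Suc.prems(2) \<open>T' \<noteq> {#}\<close>] Suc.prems(3)
    by (auto simp: reaches_def)
  note cols = connected_columns[OF M Suc.prems(1)] connected_columns[OF M' Suc.prems(2)]
  have rows: "rows M = rows M'" "rows T = rows (add_mset ?c M)"
    using connected_rows[OF M] connected_rows[OF M'] Suc.prems(3) rows_add_mset_cancel by metis+
  from rows(2) have "image_mset fst T = image_mset fst (add_mset ?c M)" by (simp add: rows_def)
  from arg_cong[OF this, of size] have "k = size M" using Suc.hyps(2) by simp
  then have "connected a n M M'" using Suc.hyps(1) cols rows by auto
  then have "connected a n (add_mset ?c M) (add_mset ?c M')"
    using cols by (intro connected_add_mset) auto
  with M connected_sym[OF M'] show ?case by (meson rtranclp_trans)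
qed

section \<open>Kernels of substitutions by signed monomials\<close>

abbreviation monomial_subst :: "('v \<Rightarrow> ('w, 'k::comm_ring_1) mpoly) \<Rightarrow> ('v \<Rightarrow>\<^sub>0 nat) \<Rightarrow> ('w, 'k) mpoly" where
  "monomial_subst \<phi> m \<equiv> \<Prod>v\<in>Poly_Mapping.keys m. \<phi> v ^ Poly_Mapping.lookup m v"

lemma monomial_subst_superset:
  assumes "finite S" "Poly_Mapping.keys m \<subseteq> S"
  shows "monomial_subst \<phi> m = (\<Prod>v\<in>S. \<phi> v ^ Poly_Mapping.lookup m v)"
  using assms by (intro prod.mono_neutral_left) (auto simp: in_keys_iff)

lemma monomial_subst_add: "monomial_subst \<phi> (m + m') = monomial_subst \<phi> m * monomial_subst \<phi> m'"
proof -
  let ?S = "Poly_Mapping.keys m \<union> Poly_Mapping.keys m'"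
  have "monomial_subst \<phi> (m + m') = (\<Prod>v\<in>?S. \<phi> v ^ Poly_Mapping.lookup (m + m') v)"
    using Poly_Mapping.keys_add[of m m'] by (intro monomial_subst_superset) auto
  also have "\<dots> = (\<Prod>v\<in>?S. \<phi> v ^ Poly_Mapping.lookup m v) * (\<Prod>v\<in>?S. \<phi> v ^ Poly_Mapping.lookup m' v)"
    by (simp add: lookup_add power_add prod.distrib)
  also have "\<dots> = monomial_subst \<phi> m * monomial_subst \<phi> m'"
    by (simp add: monomial_subst_superset[of ?S])
  finally show ?thesis .
qed

lemma poly_subst_superset:
  assumes "finite S" "Poly_Mapping.keys p \<subseteq> S"
  shows "poly_subst \<phi> p = (\<Sum>m\<in>S. Const (Poly_Mapping.lookup p m) * monomial_subst \<phi> m)"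
  unfolding poly_subst_def using assms
  by (intro sum.mono_neutral_left) (auto simp: in_keys_iff Const_def)

lemma poly_subst_add: "poly_subst \<phi> (p + q) = poly_subst \<phi> p + poly_subst \<phi> q"
proof -
  let ?S = "Poly_Mapping.keys p \<union> Poly_Mapping.keys q"
  have "poly_subst \<phi> (p + q) = (\<Sum>m\<in>?S. Const (Poly_Mapping.lookup (p + q) m) * monomial_subst \<phi> m)"
    using Poly_Mapping.keys_add[of p q] by (intro poly_subst_superset) auto
  also have "\<dots> = poly_subst \<phi> p + poly_subst \<phi> q"
    by (simp add: poly_subst_superset[of ?S] lookup_add Const_def single_add distrib_right sum.distrib)
  finally show ?thesis .
qed

lemma poly_subst_single: "poly_subst \<phi> (Poly_Mapping.single m c) = Const c * monomial_subst \<phi> m"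
  by (cases "c = 0") (simp_all add: poly_subst_def Const_def)

lemma mpoly_induct [case_names single add]:
  fixes p :: "('v, 'k::comm_ring_1) mpoly"
  assumes single: "\<And>m c. P (Poly_Mapping.single m c)" and add: "\<And>p q. P p \<Longrightarrow> P q \<Longrightarrow> P (p + q)"
  shows "P p"
proof -
  have "P (\<Sum>m\<in>S. Poly_Mapping.single m (Poly_Mapping.lookup p m))" if "finite S" for S
    using that
  proof (induction S)
    case empty
    show ?case using single[of 0 0] by simp
  qed (simp add: single add)
  moreover have "p = (\<Sum>m\<in>Poly_Mapping.keys p. Poly_Mapping.single m (Poly_Mapping.lookup p m))"
    by (rule poly_mapping_eqI) (simp add: lookup_sum lookup_single when_def in_keys_iff)
  ultimately show ?thesis by (metis finite_keys)
qed

lemma poly_subst_mult: "poly_subst \<phi> (p * q) = poly_subst \<phi> p * poly_subst \<phi> q"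
proof (induction p rule: mpoly_induct)
  case (single m c)
  show ?case
  proof (induction q rule: mpoly_induct)
    case (single m' c')
    have Const: "Const (c * c') = Const c * Const c'" by (simp add: Const_def mult_single)
    show ?case by (simp add: mult_single poly_subst_single monomial_subst_add Const mult.assoc mult.left_commute)
  qed (simp add: distrib_left poly_subst_add)
qed (simp add: distrib_right poly_subst_add)

lemma poly_subst_one: "poly_subst \<phi> 1 = 1"
  using poly_subst_single[of \<phi> 0 1] by (simp add: Const_def)

lemma poly_subst_diff: "poly_subst \<phi> (p - q) = poly_subst \<phi> p - poly_subst \<phi> q"
  using poly_subst_add[of \<phi> "p - q" q] by simp

lemma mem_kernel_iff:
  "f \<in> a_kernel (poly_ring V) (poly_ring W) h \<longleftrightarrow> indets f \<subseteq> V \<and> h f = 0"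
  by (simp add: a_kernel_def' poly_ring_def)

text \<open>The kernel depends on the target ring only through its zero, so it may be taken in the ring of
  all polynomials, where the images need not be located.\<close>

lemma ideal_kernel_poly_subst:
  fixes \<phi> :: "'v \<Rightarrow> ('w, 'k::comm_ring_1) mpoly"
  shows "ideal (a_kernel (poly_ring V) (poly_ring W) (poly_subst \<phi>)) (poly_ring V)"
proof -
  have "ring_hom_ring (poly_ring V) (poly_ring UNIV) (poly_subst \<phi>)"
    by (intro ring_hom_ringI2 cring.axioms(1)[OF cring_poly_ring] ring_hom_memI)
      (simp_all add: poly_ring_def poly_subst_add poly_subst_mult poly_subst_one)
  then have "ideal (a_kernel (poly_ring V) (poly_ring UNIV) (poly_subst \<phi>)) (poly_ring V)"
    by (rule ring_hom_ring.kernel_is_ideal)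
  moreover have "a_kernel (poly_ring V) (poly_ring UNIV) (poly_subst \<phi>) =
      a_kernel (poly_ring V) (poly_ring W) (poly_subst \<phi>)"
    by (auto simp: mem_kernel_iff)
  ultimately show ?thesis by simp
qed

lemma ideal_poly_ring_closed:
  assumes "ideal J (poly_ring V)"
  shows "0 \<in> J"
    and "p \<in> J \<Longrightarrow> q \<in> J \<Longrightarrow> p + q \<in> J"
    and "p \<in> J \<Longrightarrow> indets q \<subseteq> V \<Longrightarrow> q * p \<in> J"
  using additive_subgroup.zero_closed[OF ideal.axioms(1)[OF assms]]
    additive_subgroup.a_closed[OF ideal.axioms(1)[OF assms], of p q]
    ideal.I_l_closed[OF assms, of p q]
  by (simp_all add: poly_ring_def)

text \<open>A toric ideal is spanned by binomials, in a version with signs: if a substitution maps monomials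
  to monomials up to units \<open>s\<close> with \<open>s * s = 1\<close>, then a polynomial \<open>f\<close> in its kernel that contains a
  monomial \<open>m\<close> must contain another monomial \<open>k\<close> with the same image up to such a unit, since otherwise the
  image of \<open>m\<close> could not cancel. Subtracting a multiple of the binomial of \<open>m\<close> and \<open>k\<close> removes \<open>m\<close>
  from \<open>f\<close> and introduces no new monomial.\<close>

lemma kernel_poly_subst_subset_ideal:
  fixes \<phi> :: "'v \<Rightarrow> ('w, 'k::comm_ring_1) mpoly"
  assumes J: "ideal J (poly_ring V)"
    and monomial: "\<And>m. Poly_Mapping.keys m \<subseteq> V \<Longrightarrow>
      \<exists>x s. monomial_subst \<phi> m = Poly_Mapping.single x s \<and> s * s = 1"
    and binomial: "\<And>m m' x s s'. Poly_Mapping.keys m \<subseteq> V \<Longrightarrow> Poly_Mapping.keys m' \<subseteq> V \<Longrightarrow>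
      monomial_subst \<phi> m = Poly_Mapping.single x s \<Longrightarrow> s * s = 1 \<Longrightarrow>
      monomial_subst \<phi> m' = Poly_Mapping.single x s' \<Longrightarrow> s' * s' = 1 \<Longrightarrow>
      Poly_Mapping.single m s - Poly_Mapping.single m' s' \<in> J"
    and f: "indets f \<subseteq> V" "poly_subst \<phi> f = 0"
  shows "f \<in> J"
  using f
proof (induction "card (Poly_Mapping.keys f)" arbitrary: f rule: less_induct)
  case less
  show ?case
  proof (cases "f = 0")
    case True
    with J show ?thesis by (simp add: ideal_poly_ring_closed)
  next
    case False
    then obtain m where m: "m \<in> Poly_Mapping.keys f" by fastforce
    have V: "Poly_Mapping.keys m \<subseteq> V" if "m \<in> Poly_Mapping.keys f" for m
      using less.prems(1) that by (auto simp: indets_def)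
    from monomial[OF V[OF m]] obtain x s
      where xs: "monomial_subst \<phi> m = Poly_Mapping.single x s" "s * s = 1" by blast
    define c where "c = Poly_Mapping.lookup f m"
    define coeff where "coeff k = Poly_Mapping.lookup
      (Const (Poly_Mapping.lookup f k) * monomial_subst \<phi> k) x" for k
    have "coeff m = c * s"
      by (simp add: coeff_def c_def xs Const_def mult_single)
    moreover have "c * s \<noteq> 0"
    proof
      assume "c * s = 0"
      then have "c * (s * s) = 0" by (simp flip: mult.assoc)
      with xs(2) m show False by (simp add: c_def in_keys_iff)
    qed
    moreover have "(\<Sum>k\<in>Poly_Mapping.keys f. coeff k) = Poly_Mapping.lookup (poly_subst \<phi> f) x"
      by (simp add: coeff_def poly_subst_def lookup_sum)
    ultimately have "(\<Sum>k\<in>Poly_Mapping.keys f - {m}. coeff k) \<noteq> 0"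
      using less.prems(2) m sum.remove[of "Poly_Mapping.keys f" m coeff] by auto
    then obtain k where k: "k \<in> Poly_Mapping.keys f" "k \<noteq> m" "coeff k \<noteq> 0"
      using sum.not_neutral_contains_not_neutral by force
    from monomial[OF V[OF k(1)]] obtain y t
      where yt: "monomial_subst \<phi> k = Poly_Mapping.single y t" "t * t = 1" by blast
    with k(3) have "y = x"
      by (auto simp: coeff_def Const_def mult_single lookup_single when_def split: if_splits)
    \<comment> \<open>The factor \<open>s\<close> in the multiplier \<open>c * s\<close> cancels the \<open>s\<close> in front of \<open>m\<close> in \<open>b\<close>, as \<open>s * s = 1\<close>.\<close>
    define b where "b = Poly_Mapping.single m s - Poly_Mapping.single k t"
    define g where "g = f - Const (c * s) * b"
    have "b \<in> J"
      unfolding b_def using binomial[OF V[OF m] V[OF k(1)]] xs yt \<open>y = x\<close> by simp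
    then have cb: "Const (c * s) * b \<in> J"
      using J by (intro ideal_poly_ring_closed) (auto simp: Const_def indets_def)
    have g_eq: "g = f - Poly_Mapping.single m c + Poly_Mapping.single k (c * s * t)"
      using xs(2) by (simp add: g_def b_def Const_def right_diff_distrib mult_single mult.assoc)
    have "Poly_Mapping.keys g \<subseteq> Poly_Mapping.keys f - {m}"
    proof
      fix l assume "l \<in> Poly_Mapping.keys g"
      then have "Poly_Mapping.lookup f l - Poly_Mapping.lookup (Poly_Mapping.single m c) l
          + Poly_Mapping.lookup (Poly_Mapping.single k (c * s * t)) l \<noteq> 0"
        by (simp add: g_eq in_keys_iff lookup_add lookup_minus)
      with k m show "l \<in> Poly_Mapping.keys f - {m}"
        by (auto simp: lookup_single when_def c_def in_keys_iff split: if_splits)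
    qed
    then have "card (Poly_Mapping.keys g) < card (Poly_Mapping.keys f)" "indets g \<subseteq> V"
      using m less.prems(1) by (auto intro!: psubset_card_mono simp: indets_def)
    moreover have "poly_subst \<phi> g = 0"
      using less.prems(2) xs yt \<open>y = x\<close>
      by (simp add: g_def b_def poly_subst_diff poly_subst_mult poly_subst_single Const_def mult_single)
    ultimately have "g \<in> J" by (rule less.hyps)
    moreover have "f = g + Const (c * s) * b" by (simp add: g_def)
    ultimately show ?thesis using ideal_poly_ring_closed(2)[OF J] cb by metis
  qed
qed

definition mset_monomial :: "'v multiset \<Rightarrow> ('v \<Rightarrow>\<^sub>0 nat)" where
  "mset_monomial M = (\<Sum>v\<in>#M. Poly_Mapping.single v 1)"

lemma mset_monomial_union: "mset_monomial (M + N) = mset_monomial M + mset_monomial N"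
  by (simp add: mset_monomial_def)

lemma lookup_mset_monomial: "Poly_Mapping.lookup (mset_monomial M) = count M"
  by (induction M) (auto simp: mset_monomial_def lookup_add lookup_single when_def)

lemma keys_mset_monomial: "Poly_Mapping.keys (mset_monomial M) = set_mset M"
  by (auto simp: in_keys_iff lookup_mset_monomial)

lemma mdegree_mset_monomial: "mdegree (mset_monomial M) = size M"
  by (simp add: mdegree_def keys_mset_monomial lookup_mset_monomial size_multiset_overloaded_eq)

lemma monomial_subst_mset_monomial:
  "monomial_subst \<phi> (mset_monomial M) = (\<Prod>v\<in>#M. \<phi> v)"
  by (simp add: keys_mset_monomial lookup_mset_monomial image_prod_mset_multiplicity)

lemma ex_mset_monomial: "\<exists>M. m = mset_monomial M \<and> set_mset M = Poly_Mapping.keys m"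
proof -
  have "m = mset_monomial (Abs_multiset (Poly_Mapping.lookup m))"
    by (rule poly_mapping_eqI) (simp add: lookup_mset_monomial)
  then show ?thesis by (metis keys_mset_monomial)
qed

section \<open>The monomials of the block diagonal matching field\<close>

abbreviation support :: "column \<Rightarrow> nat set" where
  "support \<equiv> \<lambda>(p, q, r). {p, q, r}"

definition column_exponent :: "column \<Rightarrow> nat \<times> nat \<Rightarrow>\<^sub>0 nat" where
  "column_exponent = (\<lambda>(p, q, r). Poly_Mapping.single (1, p) 1 + Poly_Mapping.single (2, q) 1
     + Poly_Mapping.single (3, r) 1)"

lemma lookup_sum_column_exponent:
  defines "e \<equiv> \<lambda>T. Poly_Mapping.lookup (\<Sum>c\<in>#T. column_exponent c)"
  shows "e T (1, j) = count (image_mset fst T) j"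
    and "e T (2, j) = count (image_mset (fst \<circ> snd) T) j"
    and "e T (3, j) = count (image_mset (snd \<circ> snd) T) j"
  unfolding e_def
  by (induction T) (auto simp: column_exponent_def lookup_add lookup_single when_def)

text \<open>This makes tableaux with equal rows the same thing as monomials with equal images up to sign:
  the exponent of \<open>x\<^sub>i\<^sub>j\<close> counts how often \<open>j\<close> occurs in the \<open>i\<close>-th row.\<close>

lemma sum_column_exponent_eq_iff:
  "(\<Sum>c\<in>#T. column_exponent c) = (\<Sum>c\<in>#T'. column_exponent c) \<longleftrightarrow> rows T = rows T'"
proof
  assume "(\<Sum>c\<in>#T. column_exponent c) = (\<Sum>c\<in>#T'. column_exponent c)"
  then show "rows T = rows T'"
    using lookup_sum_column_exponent[of T] lookup_sum_column_exponent[of T']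
    by (auto simp: rows_def intro!: multiset_eqI)
next
  have split: "(\<Sum>c\<in>#T. column_exponent c) =
    (\<Sum>p\<in>#image_mset fst T. Poly_Mapping.single (1, p) 1) +
    (\<Sum>q\<in>#image_mset (fst \<circ> snd) T. Poly_Mapping.single (2, q) 1) +
    (\<Sum>r\<in>#image_mset (snd \<circ> snd) T. Poly_Mapping.single (3, r) 1)" for T
    by (induction T) (auto simp: column_exponent_def add_ac)
  assume "rows T = rows T'"
  then show "(\<Sum>c\<in>#T. column_exponent c) = (\<Sum>c\<in>#T'. column_exponent c)"
    unfolding split rows_def by simp
qed

lemma block_diagonal_triple:
  assumes "1 \<le> i" "i < j" "j < k" "k \<le> a1 + a2"
  shows "block_diagonal a1 a2 {i, j, k} = (if i \<le> a1 \<and> a1 < j then transpose 1 2 else id)"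
proof -
  have first_block:
    "(LEAST t. t \<in> {1, 2} \<and> block a1 a2 t \<inter> {i, j, k} \<noteq> {}) = (if i \<le> a1 then 1 else 2)"
    using assms by (intro Least_equality) (auto simp: block_def)
  consider "i \<le> a1" "a1 < j" | "j \<le> a1" | "a1 < i" by linarith
  then show ?thesis
  proof cases
    case 1
    then have "{i, j, k} \<inter> block a1 a2 1 = {i}" using assms by (auto simp: block_def)
    then have "card ({i, j, k} \<inter> block a1 a2 1) = 1" by simp
    with 1 show ?thesis unfolding block_diagonal_def first_block Let_def by simp
  next
    case 2
    then have "{i, j} \<subseteq> {i, j, k} \<inter> block a1 a2 1" using assms by (auto simp: block_def)
    then have "card {i, j} \<le> card ({i, j, k} \<inter> block a1 a2 1)" by (intro card_mono) auto
    then have "2 \<le> card ({i, j, k} \<inter> block a1 a2 1)" using assms by simp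
    with 2 assms show ?thesis unfolding block_diagonal_def first_block Let_def by simp
  next
    case 3
    then have "{i, j, k} \<inter> block a1 a2 2 = {i, j, k}" using assms by (auto simp: block_def)
    then have "2 \<le> card ({i, j, k} \<inter> block a1 a2 2)" using assms by simp
    with 3 show ?thesis unfolding block_diagonal_def first_block Let_def by simp
  qed
qed

lemma sorted_list_of_triple:
  "i < j \<Longrightarrow> j < k \<Longrightarrow> sorted_list_of_set {i, j, k} = [i, j, k :: nat]"
  using sorted_list_of_set.idem_if_sorted_distinct[of "[i, j, k]"] by simp

text \<open>If \<open>p > q\<close>, then \<open>q\<close> is the only entry in the first block, and the transposition puts the smaller
  entry \<open>q\<close> into the second row.\<close>

lemma matching_monomial_support:
  assumes "(p, q, r) \<in> columns a1 (a1 + a2)"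
  shows "matching_monomial (block_diagonal a1 a2) {p, q, r} =
    Poly_Mapping.single (column_exponent (p, q, r)) 1"
proof -
  have "{1..3} = {1, 2, 3 :: nat}" by auto
  then have monomial: "matching_monomial (block_diagonal a1 a2) {i, j, k} =
      (if i \<le> a1 \<and> a1 < j then Var (2, i) * Var (1, j) * Var (3, k)
       else Var (1, i) * Var (2, j) * Var (3, k))"
    if "1 \<le> i" "i < j" "j < k" "k \<le> a1 + a2" for i j k
    using that by (simp add: matching_monomial_def block_diagonal_triple sorted_list_of_triple mult_ac
        del: One_nat_def)
  have single: "Poly_Mapping.single (column_exponent (p, q, r)) 1 = Var (1, p) * Var (2, q) * Var (3, r)"
    by (simp add: column_exponent_def Var_def mult_single)
  show ?thesis
  proof (cases "p < q")
    case True
    then show ?thesis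
      using assms monomial[of p q r] by (auto simp: columns_def single)
  next
    case False
    with assms have "q \<le> a1" "a1 < p" "p < r" "1 \<le> q" "r \<le> a1 + a2" by (auto simp: columns_def)
    moreover have "{p, q, r} = {q, p, r}" by auto
    ultimately show ?thesis
      using monomial[of q p r] by (simp add: single mult_ac)
  qed
qed

lemma triples_eq_support_columns: "triples (a1 + a2) = support ` columns a1 (a1 + a2)"
proof (intro equalityI subsetI)
  fix I assume "I \<in> triples (a1 + a2)"
  then have I: "I \<subseteq> {1..a1 + a2}" "card I = 3" "finite I"
    by (auto simp: triples_def intro: finite_subset)
  define xs where "xs = sorted_list_of_set I"
  have "length xs = 3" "sorted_wrt (<) xs" "set xs = I" using I by (simp_all add: xs_def)
  then obtain i j k where ijk: "I = {i, j, k}" "i < j" "j < k"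
    by (auto simp: numeral_3_eq_3 length_Suc_conv)
  show "I \<in> support ` columns a1 (a1 + a2)"
  proof (cases "i \<le> a1 \<and> a1 < j")
    case True
    then have "(j, i, k) \<in> columns a1 (a1 + a2)" "I = {j, i, k}"
      using I ijk by (auto simp: columns_def)
    then show ?thesis by (metis (no_types, lifting) case_prod_conv image_eqI)
  next
    case False
    then have "(i, j, k) \<in> columns a1 (a1 + a2)" using I ijk by (auto simp: columns_def)
    then show ?thesis using ijk(1) by (metis (no_types, lifting) case_prod_conv image_eqI)
  qed
next
  fix I assume "I \<in> support ` columns a1 (a1 + a2)"
  then show "I \<in> triples (a1 + a2)" by (auto simp: columns_def triples_def card_insert_if)
qed

section \<open>Generation by quadrics\<close>

definition column_sign :: "nat \<Rightarrow> nat \<Rightarrow> column multiset \<Rightarrow> int" where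
  "column_sign a1 a2 T = (\<Prod>c\<in>#T. sign (block_diagonal a1 a2 (support c)))"

lemma column_sign_square: "column_sign a1 a2 T * column_sign a1 a2 T = 1"
proof (induction T)
  case (add c T)
  have "column_sign a1 a2 (add_mset c T) * column_sign a1 a2 (add_mset c T) =
      (sign (block_diagonal a1 a2 (support c)) * sign (block_diagonal a1 a2 (support c))) *
      (column_sign a1 a2 T * column_sign a1 a2 T)"
    by (simp add: column_sign_def mult_ac)
  with add show ?case by (simp add: sign_idempotent)
qed (simp add: column_sign_def)

text \<open>The sign is chosen so that all tableaux with the same rows have the same image, without a sign;
  see \<open>poly_subst_signed_monomial\<close>.\<close>

definition signed_monomial :: "nat \<Rightarrow> nat \<Rightarrow> column multiset \<Rightarrow> (nat set, 'k::comm_ring_1) mpoly" where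
  "signed_monomial a1 a2 T =
     Poly_Mapping.single (mset_monomial (image_mset support T)) (of_int (column_sign a1 a2 T))"

lemma signed_monomial_union:
  "signed_monomial a1 a2 (S + T) = signed_monomial a1 a2 S * signed_monomial a1 a2 T"
  by (simp add: signed_monomial_def mset_monomial_union column_sign_def mult_single)

lemma indets_signed_monomial:
  assumes "set_mset T \<subseteq> columns a1 (a1 + a2)"
  shows "indets (signed_monomial a1 a2 T) \<subseteq> triples (a1 + a2)"
  using assms by (auto simp: indets_def signed_monomial_def keys_mset_monomial triples_eq_support_columns)

definition matching_image :: "nat \<Rightarrow> nat \<Rightarrow> nat set \<Rightarrow> (nat \<times> nat, 'k::comm_ring_1) mpoly" where
  "matching_image a1 a2 =
     (\<lambda>I. of_int (sign (block_diagonal a1 a2 I)) * matching_monomial (block_diagonal a1 a2) I)"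

lemma matching_image_support:
  assumes "c \<in> columns a1 (a1 + a2)"
  shows "matching_image a1 a2 (support c) =
    Poly_Mapping.single (column_exponent c) (of_int (sign (block_diagonal a1 a2 (support c))))"
  using assms
  by (cases c) (simp add: matching_image_def matching_monomial_support mult_single flip: single_of_int)

lemma monomial_subst_columns:
  assumes "set_mset T \<subseteq> columns a1 (a1 + a2)"
  shows "monomial_subst (matching_image a1 a2) (mset_monomial (image_mset support T)) =
    Poly_Mapping.single (\<Sum>c\<in>#T. column_exponent c) (of_int (column_sign a1 a2 T))"
  unfolding monomial_subst_mset_monomial using assms
  by (induction T) (simp_all add: matching_image_support mult_single column_sign_def)

lemma poly_subst_signed_monomial:
  assumes "set_mset T \<subseteq> columns a1 (a1 + a2)"
  shows "poly_subst (matching_image a1 a2) (signed_monomial a1 a2 T) =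
    Poly_Mapping.single (\<Sum>c\<in>#T. column_exponent c) 1"
  using assms column_sign_square[of a1 a2 T]
  by (simp add: signed_monomial_def poly_subst_single monomial_subst_columns Const_def mult_single
    del: single_of_int flip: of_int_mult)

lemma ex_columns_monomial:
  assumes "Poly_Mapping.keys m \<subseteq> triples (a1 + a2)"
  shows "\<exists>T. set_mset T \<subseteq> columns a1 (a1 + a2) \<and> m = mset_monomial (image_mset support T)"
proof -
  obtain M where M: "m = mset_monomial M" "set_mset M = Poly_Mapping.keys m"
    using ex_mset_monomial by metis
  have "\<exists>T. set_mset T \<subseteq> columns a1 (a1 + a2) \<and> M = image_mset support T"
    if "set_mset M \<subseteq> support ` columns a1 (a1 + a2)" for M
    using that
  proof (induction M)
    case empty
    then show ?case by (auto intro: exI[of _ "{#}"])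
  next
    case (add I M)
    then obtain T c where "set_mset T \<subseteq> columns a1 (a1 + a2)" "M = image_mset support T"
      "c \<in> columns a1 (a1 + a2)" "I = support c" by auto
    then show ?case by (intro exI[of _ "add_mset c T"]) auto
  qed
  with M assms show ?thesis unfolding triples_eq_support_columns by metis
qed

text \<open>A single move changes the signed monomial by a multiple of a quadric in the kernel, and along a
  chain of moves the differences telescope.\<close>

lemma connected_binomial_mem:
  fixes J :: "(nat set, 'k::comm_ring_1) mpoly set"
  assumes J: "ideal J (poly_ring (triples (a1 + a2)))"
    and quadrics: "\<And>g. indets g \<subseteq> triples (a1 + a2) \<Longrightarrow> homogeneous 2 g \<Longrightarrow>
      poly_subst (matching_image a1 a2) g = 0 \<Longrightarrow> g \<in> J"
    and "connected a1 (a1 + a2) T T'"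
  shows "signed_monomial a1 a2 T - signed_monomial a1 a2 T' \<in> J"
  using assms(3)
proof (induction rule: rtranclp_induct)
  case base
  show ?case using J by (simp add: ideal_poly_ring_closed)
next
  case (step S S')
  note step(2)
  then have "signed_monomial a1 a2 S - signed_monomial a1 a2 S' \<in> J"
  proof cases
    case (1 c d c' d' M)
    let ?g = "signed_monomial a1 a2 {#c, d#} - signed_monomial a1 a2 {#c', d'#} :: (nat set, 'k) mpoly"
    have "indets ?g \<subseteq> triples (a1 + a2)"
    proof -
      have "indets ?g \<subseteq> indets (signed_monomial a1 a2 {#c, d#} :: (nat set, 'k) mpoly) \<union>
          indets (signed_monomial a1 a2 {#c', d'#} :: (nat set, 'k) mpoly)"
        using keys_diff by (fastforce simp: indets_def)
      moreover have "indets (signed_monomial a1 a2 {#c, d#} :: (nat set, 'k) mpoly) \<subseteq> triples (a1 + a2)"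
        "indets (signed_monomial a1 a2 {#c', d'#} :: (nat set, 'k) mpoly) \<subseteq> triples (a1 + a2)"
        using 1(3) by (auto intro!: indets_signed_monomial)
      ultimately show ?thesis by blast
    qed
    moreover have "homogeneous 2 ?g"
      unfolding homogeneous_def
    proof
      fix m assume "m \<in> Poly_Mapping.keys ?g"
      then have "m \<in> {mset_monomial (image_mset support {#c, d#}),
          mset_monomial (image_mset support {#c', d'#})}"
        using keys_diff[of "signed_monomial a1 a2 {#c, d#} :: (nat set, 'k) mpoly"
            "signed_monomial a1 a2 {#c', d'#}"]
        unfolding signed_monomial_def by (auto split: if_splits)
      then show "mdegree m = 2" by (auto simp: mdegree_mset_monomial)
    qed
    moreover have "poly_subst (matching_image a1 a2) ?g = 0"
    proof -
      have "(\<Sum>c\<in>#{#c, d#}. column_exponent c) = (\<Sum>c\<in>#{#c', d'#}. column_exponent c)"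
        using 1(4) by (simp only: sum_column_exponent_eq_iff)
      then show ?thesis
        using 1(3) by (simp add: poly_subst_diff poly_subst_signed_monomial)
    qed
    ultimately have "?g \<in> J" by (rule quadrics)
    moreover have "indets (signed_monomial a1 a2 M :: (nat set, 'k) mpoly) \<subseteq> triples (a1 + a2)"
      using 1(3) by (intro indets_signed_monomial) auto
    ultimately have "signed_monomial a1 a2 M * ?g \<in> J"
      using J by (intro ideal_poly_ring_closed)
    moreover have "S = M + {#c, d#}" "S' = M + {#c', d'#}" using 1 by simp_all
    ultimately show ?thesis 
      by (simp add: right_diff_distrib signed_monomial_union del: union_mset_add_mset_right)
  qed
  with step.IH show ?case using ideal_poly_ring_closed(2)[OF J] by fastforce
qed

lemma matching_field_ideal_subset:
  fixes J :: "(nat set, 'k::comm_ring_1) mpoly set"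
  assumes J: "ideal J (poly_ring (triples (a1 + a2)))"
    and quadrics: "\<And>g. indets g \<subseteq> triples (a1 + a2) \<Longrightarrow> homogeneous 2 g \<Longrightarrow>
      poly_subst (matching_image a1 a2) g = 0 \<Longrightarrow> g \<in> J"
    and f: "indets f \<subseteq> triples (a1 + a2)" "poly_subst (matching_image a1 a2) f = 0"
  shows "f \<in> J"
proof (rule kernel_poly_subst_subset_ideal[OF J _ _ f])
  fix m :: "nat set \<Rightarrow>\<^sub>0 nat" assume "Poly_Mapping.keys m \<subseteq> triples (a1 + a2)"
  from ex_columns_monomial[OF this] obtain T
    where T: "set_mset T \<subseteq> columns a1 (a1 + a2)" "m = mset_monomial (image_mset support T)" by blast
  have "(of_int (column_sign a1 a2 T) * of_int (column_sign a1 a2 T) :: 'k) = 1"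
    using column_sign_square[of a1 a2 T] by (simp flip: of_int_mult)
  with monomial_subst_columns[OF T(1)] T(2)
  show "\<exists>x s. monomial_subst (matching_image a1 a2) m = Poly_Mapping.single x (s :: 'k) \<and>
      s * s = 1" by blast
next
  fix m m' x and s s' :: 'k
  assume m: "Poly_Mapping.keys m \<subseteq> triples (a1 + a2)" "Poly_Mapping.keys m' \<subseteq> triples (a1 + a2)"
    "monomial_subst (matching_image a1 a2) m = Poly_Mapping.single x s" "s * s = 1"
    "monomial_subst (matching_image a1 a2) m' = Poly_Mapping.single x s'" "s' * s' = 1"
  obtain T T' where T: "set_mset T \<subseteq> columns a1 (a1 + a2)" "m = mset_monomial (image_mset support T)"
    and T': "set_mset T' \<subseteq> columns a1 (a1 + a2)" "m' = mset_monomial (image_mset support T')"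
    using ex_columns_monomial[OF m(1)] ex_columns_monomial[OF m(2)] by blast
  have inj: "y = x \<and> t = u" if "Poly_Mapping.single y t = Poly_Mapping.single x u" "u * u = 1"
    for y :: "nat \<times> nat \<Rightarrow>\<^sub>0 nat" and t u :: 'k
  proof -
    from that(2) have "u \<noteq> 0" by auto
    moreover have "Poly_Mapping.lookup (Poly_Mapping.single y t) x = u" using that(1) by simp
    ultimately show ?thesis by (auto simp: lookup_single when_def split: if_splits)
  qed
  have "(\<Sum>c\<in>#T. column_exponent c) = x \<and> of_int (column_sign a1 a2 T) = s"
    using m(3) unfolding T(2) monomial_subst_columns[OF T(1)] by (rule inj) (rule m(4))
  moreover have "(\<Sum>c\<in>#T'. column_exponent c) = x \<and> of_int (column_sign a1 a2 T') = s'"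
    using m(5) unfolding T'(2) monomial_subst_columns[OF T'(1)] by (rule inj) (rule m(6))
  ultimately have x: "(\<Sum>c\<in>#T. column_exponent c) = (\<Sum>c\<in>#T'. column_exponent c)"
      "of_int (column_sign a1 a2 T) = s" "of_int (column_sign a1 a2 T') = s'" by simp_all
  from x(1) have "rows T = rows T'" by (simp only: sum_column_exponent_eq_iff)
  then have "connected a1 (a1 + a2) T T'" by (rule same_rows_connected[OF T(1) T'(1)])
  then have "signed_monomial a1 a2 T - signed_monomial a1 a2 T' \<in> J"
    by (rule connected_binomial_mem[OF J, rotated]) (rule quadrics)
  then show "Poly_Mapping.single m s - Poly_Mapping.single m' s' \<in> J"
    by (simp add: signed_monomial_def T T' x(2,3))
qed

text \<open>As generators one can take all homogeneous elements of degree \<open>2\<close> of the ideal.\<close>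

theorem theorem1p4:
  fixes n a1 a2 :: nat
  assumes "n \<ge> 3" and "a1 > 0" and "a2 > 0" and "a1 + a2 = n"
  shows "quadratically_generated (triples n)
    (matching_field_ideal n (block_diagonal a1 a2) :: (nat set, 'k::field) mpoly set)"
proof -
  let ?R = "poly_ring (triples n) :: (nat set, 'k) mpoly ring"
  let ?K = "matching_field_ideal n (block_diagonal a1 a2) :: (nat set, 'k) mpoly set"
  have K: "f \<in> ?K \<longleftrightarrow> indets f \<subseteq> triples n \<and> poly_subst (matching_image a1 a2) f = 0" for f
    by (simp add: matching_field_ideal_def mem_kernel_iff matching_field_map_def matching_image_def)
  have ideal_K: "ideal ?K ?R"
    unfolding matching_field_ideal_def matching_field_map_def by (rule ideal_kernel_poly_subst)
  define G where "G = {g \<in> ?K. homogeneous 2 g}"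
  have ring: "ring ?R" by (rule cring.axioms(1)[OF cring_poly_ring])
  have G: "G \<subseteq> carrier ?R" by (auto simp: G_def K poly_ring_def)
  have "f \<in> Idl\<^bsub>?R\<^esub> G" if "f \<in> ?K" for f
  proof (rule matching_field_ideal_subset)
    show "ideal (Idl\<^bsub>?R\<^esub> G) (poly_ring (triples (a1 + a2)))"
      using ring.genideal_ideal[OF ring G] assms(4) by simp
    show "g \<in> Idl\<^bsub>?R\<^esub> G" if "indets g \<subseteq> triples (a1 + a2)" "homogeneous 2 g"
      "poly_subst (matching_image a1 a2) g = 0" for g
      using ring.genideal_self[OF ring G] that assms(4) by (auto simp: G_def K)
  qed (use that K assms(4) in auto)
  moreover have "Idl\<^bsub>?R\<^esub> G \<subseteq> ?K"
    by (rule ring.genideal_minimal[OF ring ideal_K]) (auto simp: G_def)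
  ultimately show ?thesis
    unfolding quadratically_generated_def using G by (intro exI[of _ G]) (auto simp: G_def)
qed

end
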